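(* Let $\mathcal{G}=\begin{pmatrix}\mathcal{A}&\mathcal{M}\\ \mathcal{N}&\mathcal{B}\end{pmatrix}$ be a generalized matrix algebra whose modules $\mathcal{M}$ and $\mathcal{N}$ are $2$-torsion free. Then $\mathcal{G}$ has the Lie derivation property if (i) $\pi_{\mathcal{A}}(Z(\mathcal{G}))=Z(\mathcal{A})$ and $\pi_{\mathcal{B}}(Z(\mathcal{G}))=Z(\mathcal{B})$, and (ii) $\mathcal{M}$ is strongly faithful.
   Context: All algebras are unital algebras over a fixed commutative unital ring $\mathbf{R}$; linear means $\mathbf{R}$-linear; $Z(\cdot)$ denotes the center; $[a,b]=ab-ba$. A module $\mathcal{M}$ is $2$-torsion free if $2m=0$ implies $m=0$ for $m\in\mathcal{M}$. Generalized matrix algebra: a Morita context consists of unital algebras $\mathcal{A},\mathcal{B}$, an $(\mathcal{A},\mathcal{B})$-bimodule $\mathcal{M}$, a $(\mathcal{B},\mathcal{A})$-bimodule $\mathcal{N}$, and bimodule homomorphisms $\Phi:\mathcal{M}\otimes_{\mathcal{B}}\mathcal{N}\to\mathcal{A}$, $\Psi:\mathcal{N}\otimes_{\mathcal{A}}\mathcal{M}\to\mathcal{B}$ such that, writing $mn=\Phi(m\otimes n)$ and $nm=\Psi(n\otimes m)$, one has $(mn)m'=m(nm')$ and $(nm)n'=n(mn')$ for all $m,m'\in\mathcal{M}$, $n,n'\in\mathcal{N}$. Then the set $\mathcal{G}$ of matrices $\begin{pmatrix}a&m\\ n&b\end{pmatrix}$ ($a\in\mathcal{A}$, $m\in\mathcal{M}$,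 $n\in\mathcal{N}$, $b\in\mathcal{B}$), with the usual matrix operations, is an algebra, called a generalized matrix algebra; it is assumed that at least one of $\mathcal{M},\mathcal{N}$ is nonzero. Writing $a\oplus b$ for the diagonal matrix $\begin{pmatrix}a&0\\0&b\end{pmatrix}$, the center is $Z(\mathcal{G})=\{a\oplus b: a\in Z(\mathcal{A}),\,b\in Z(\mathcal{B}),\ am=mb,\ na=bn\ \text{for all } m\in\mathcal{M},n\in\mathcal{N}\}$. The projections $\pi_{\mathcal{A}}:\mathcal{G}\to\mathcal{A}$ and $\pi_{\mathcal{B}}:\mathcal{G}\to\mathcal{B}$ send $\begin{pmatrix}a&m\\ n&b\end{pmatrix}$ to $a$ and to $b$, respectively. $\mathcal{M}$ is faithful as a left $\mathcal{A}$-module if $a\mathcal{M}=0$ implies $a=0$ for $a\in\mathcal{A}$, and faithful as a right $\mathcal{B}$-module if $\mathcal{M}b=0$ implies $b=0$ for $b\in\mathcal{B}$. The $(\mathcal{A},\mathcal{B})$-module $\mathcal{M}$ is strongly faithful if either: $\mathcal{M}$ is faithful as a right $\mathcal{B}$-module and $am=0$ implies $a=0$ or $m=0$ for any $a\in\mathcal{A}$, $m\in\mathcal{M}$; or $\mathcal{M}$ is faithful as a left $\mathcal{A}$-module and $mb=0$ implies $m=0$ or $b=0$ for any $m\in\mathcal{M}$, $b\in\mathcal{B}$. A derivation of an algebra $\mathcal{C}$ is a linear map $\mathcal{D}:\mathcal{C}\to\mathcal{C}$ with $\mathcal{D}(xy)=\mathcal{D}(x)y+x\mathcal{D}(y)$.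 A Lie derivation is a linear map $\mathcal{L}:\mathcal{C}\to\mathcal{C}$ with $\mathcal{L}([x,y])=[\mathcal{L}(x),y]+[x,\mathcal{L}(y)]$. A Lie derivation $\mathcal{L}$ is proper if $\mathcal{L}=\mathcal{D}+\tau$ with $\mathcal{D}:\mathcal{C}\to\mathcal{C}$ a derivation and $\tau:\mathcal{C}\to Z(\mathcal{C})$ linear. The algebra $\mathcal{C}$ has the Lie derivation property if every Lie derivation $\mathcal{C}\to\mathcal{C}$ is proper. *)

theory Defs
  imports Complex_Main
begin

text \<open>
  The multiplication of an algebra is an explicit argument in what follows, rather than the
  \<open>times\<close> class operation, because the product of a generalized matrix algebra depends on
  the Morita context and so is not determined by its type. Algebras whose product is the class
  operation are obtained by instantiating \<open>mult\<close> with \<open>(*)\<close> and \<open>one\<close> with \<open>1\<close>.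
\<close>

locale unital_algebra = module scale
  for scale :: "'r::comm_ring_1 \<Rightarrow> 'c::ab_group_add \<Rightarrow> 'c" +
  fixes mult :: "'c \<Rightarrow> 'c \<Rightarrow> 'c"
    and one :: 'c
  assumes mult_linear_left: "module_hom scale scale (\<lambda>x. mult x y)"
    and mult_linear_right: "module_hom scale scale (\<lambda>y. mult x y)"
    and mult_assoc: "mult (mult x y) z = mult x (mult y z)"
    and mult_one_left: "mult one x = x"
    and mult_one_right: "mult x one = x"

definition alg_center :: "('c \<Rightarrow> 'c \<Rightarrow> 'c) \<Rightarrow> 'c set" where
  "alg_center mult = {z. \<forall>x. mult z x = mult x z}"

definition lie_bracket :: "('c::ab_group_add \<Rightarrow> 'c \<Rightarrow> 'c) \<Rightarrow> 'c \<Rightarrow> 'c \<Rightarrow> 'c" where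
  "lie_bracket mult x y = mult x y - mult y x"

definition derivation ::
    "('r::comm_ring_1 \<Rightarrow> 'c::ab_group_add \<Rightarrow> 'c) \<Rightarrow> ('c \<Rightarrow> 'c \<Rightarrow> 'c) \<Rightarrow> ('c \<Rightarrow> 'c) \<Rightarrow> bool" where
  "derivation scale mult D \<longleftrightarrow>
     module_hom scale scale D \<and> (\<forall>x y. D (mult x y) = mult (D x) y + mult x (D y))"

definition lie_derivation ::
    "('r::comm_ring_1 \<Rightarrow> 'c::ab_group_add \<Rightarrow> 'c) \<Rightarrow> ('c \<Rightarrow> 'c \<Rightarrow> 'c) \<Rightarrow> ('c \<Rightarrow> 'c) \<Rightarrow> bool" where
  "lie_derivation scale mult L \<longleftrightarrow>
     module_hom scale scale L \<and>
     (\<forall>x y. L (lie_bracket mult x y) = lie_bracket mult (L x) y + lie_bracket mult x (L y))"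

definition proper_lie_derivation ::
    "('r::comm_ring_1 \<Rightarrow> 'c::ab_group_add \<Rightarrow> 'c) \<Rightarrow> ('c \<Rightarrow> 'c \<Rightarrow> 'c) \<Rightarrow> ('c \<Rightarrow> 'c) \<Rightarrow> bool" where
  "proper_lie_derivation scale mult L \<longleftrightarrow>
     lie_derivation scale mult L \<and>
     (\<exists>D \<tau>. derivation scale mult D \<and> module_hom scale scale \<tau> \<and>
            range \<tau> \<subseteq> alg_center mult \<and> (\<forall>x. L x = D x + \<tau> x))"

definition lie_derivation_property ::
    "('r::comm_ring_1 \<Rightarrow> 'c::ab_group_add \<Rightarrow> 'c) \<Rightarrow> ('c \<Rightarrow> 'c \<Rightarrow> 'c) \<Rightarrow> bool" where
  "lie_derivation_property scale mult \<longleftrightarrow>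
     (\<forall>L. lie_derivation scale mult L \<longrightarrow> proper_lie_derivation scale mult L)"

text \<open>
  In a bimodule over two algebras the ground ring acts the same way from both sides: the
  bilinearity assumptions give \<open>lact (scaleA r 1) x = scaleX r x = ract x (scaleB r 1)\<close>.
\<close>

locale alg_bimodule =
  A: unital_algebra scaleA "(*)" 1 + B: unital_algebra scaleB "(*)" 1 + X: module scaleX
  for scaleA :: "'r::comm_ring_1 \<Rightarrow> 'a::ring_1 \<Rightarrow> 'a"
    and scaleB :: "'r \<Rightarrow> 'b::ring_1 \<Rightarrow> 'b"
    and scaleX :: "'r \<Rightarrow> 'x::ab_group_add \<Rightarrow> 'x" +
  fixes lact :: "'a \<Rightarrow> 'x \<Rightarrow> 'x"
    and ract :: "'x \<Rightarrow> 'b \<Rightarrow> 'x"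
  assumes lact_linear_left: "module_hom scaleA scaleX (\<lambda>a. lact a x)"
    and lact_linear_right: "module_hom scaleX scaleX (\<lambda>x. lact a x)"
    and ract_linear_left: "module_hom scaleX scaleX (\<lambda>x. ract x b)"
    and ract_linear_right: "module_hom scaleB scaleX (\<lambda>b. ract x b)"
    and lact_one: "lact 1 x = x"
    and ract_one: "ract x 1 = x"
    and lact_mult: "lact (a * a') x = lact a (lact a' x)"
    and ract_mult: "ract x (b * b') = ract (ract x b) b'"
    and lact_ract: "ract (lact a x) b = lact a (ract x b)"

text \<open>
  The bimodule homomorphisms \<open>\<Phi> : M \<otimes> N \<rightarrow> A\<close> and \<open>\<Psi> : N \<otimes> M \<rightarrow> B\<close> (tensor products over
  \<open>B\<close> and \<open>A\<close>) are represented by the corresponding balanced bilinear maps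
  \<open>\<phi> m n = \<Phi> (m \<otimes> n)\<close> and \<open>\<psi> n m = \<Psi> (n \<otimes> m)\<close>, i.e. through the universal property defining
  these tensor products. Balancedness is the condition \<open>(m b) n = m (b n)\<close>, respectively
  \<open>(n a) m = n (a m)\<close>.
\<close>

locale morita_context =
  M: alg_bimodule scaleA scaleB scaleM lactM ractM +
  N: alg_bimodule scaleB scaleA scaleN lactN ractN
  for scaleA :: "'r::comm_ring_1 \<Rightarrow> 'a::ring_1 \<Rightarrow> 'a"
    and scaleB :: "'r \<Rightarrow> 'b::ring_1 \<Rightarrow> 'b"
    and scaleM :: "'r \<Rightarrow> 'm::ab_group_add \<Rightarrow> 'm"
    and scaleN :: "'r \<Rightarrow> 'n::ab_group_add \<Rightarrow> 'n"
    and lactM :: "'a \<Rightarrow> 'm \<Rightarrow> 'm"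
    and ractM :: "'m \<Rightarrow> 'b \<Rightarrow> 'm"
    and lactN :: "'b \<Rightarrow> 'n \<Rightarrow> 'n"
    and ractN :: "'n \<Rightarrow> 'a \<Rightarrow> 'n" +
  fixes \<phi> :: "'m \<Rightarrow> 'n \<Rightarrow> 'a"
    and \<psi> :: "'n \<Rightarrow> 'm \<Rightarrow> 'b"
  assumes \<phi>_linear_left: "module_hom scaleM scaleA (\<lambda>m. \<phi> m n)"
    and \<phi>_linear_right: "module_hom scaleN scaleA (\<lambda>n. \<phi> m n)"
    and \<phi>_balanced: "\<phi> (ractM m b) n = \<phi> m (lactN b n)"
    and \<phi>_lact: "\<phi> (lactM a m) n = a * \<phi> m n"
    and \<phi>_ract: "\<phi> m (ractN n a) = \<phi> m n * a"
    and \<psi>_linear_left: "module_hom scaleN scaleB (\<lambda>n. \<psi> n m)"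
    and \<psi>_linear_right: "module_hom scaleM scaleB (\<lambda>m. \<psi> n m)"
    and \<psi>_balanced: "\<psi> (ractN n a) m = \<psi> n (lactM a m)"
    and \<psi>_lact: "\<psi> (lactN b n) m = b * \<psi> n m"
    and \<psi>_ract: "\<psi> n (ractM m b) = \<psi> n m * b"
    and assoc_M: "lactM (\<phi> m n) m' = ractM m (\<psi> n m')"
    and assoc_N: "lactN (\<psi> n m) n' = ractN n (\<phi> m n')"

datatype ('a, 'm, 'n, 'b) gmat =
  GMat (entry11: 'a) (entry12: 'm) (entry21: 'n) (entry22: 'b)

instantiation gmat :: (ab_group_add, ab_group_add, ab_group_add, ab_group_add) ab_group_add
begin

definition "0 = GMat 0 0 0 0"

definition "x + y =
  GMat (entry11 x + entry11 y) (entry12 x + entry12 y) (entry21 x + entry21 y) (entry22 x + entry22 y)"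

definition "x - y =
  GMat (entry11 x - entry11 y) (entry12 x - entry12 y) (entry21 x - entry21 y) (entry22 x - entry22 y)"

definition "- x = GMat (- entry11 x) (- entry12 x) (- entry21 x) (- entry22 x)"

instance
  by standard
    (simp_all add: zero_gmat_def plus_gmat_def minus_gmat_def uminus_gmat_def algebra_simps)

end

definition gmat_scale ::
    "('r \<Rightarrow> 'a \<Rightarrow> 'a) \<Rightarrow> ('r \<Rightarrow> 'b \<Rightarrow> 'b) \<Rightarrow> ('r \<Rightarrow> 'm \<Rightarrow> 'm) \<Rightarrow> ('r \<Rightarrow> 'n \<Rightarrow> 'n)
      \<Rightarrow> 'r \<Rightarrow> ('a, 'm, 'n, 'b) gmat \<Rightarrow> ('a, 'm, 'n, 'b) gmat" where
  "gmat_scale scaleA scaleB scaleM scaleN r x =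
     GMat (scaleA r (entry11 x)) (scaleM r (entry12 x)) (scaleN r (entry21 x)) (scaleB r (entry22 x))"

definition gmat_mult ::
    "('a::ring_1 \<Rightarrow> 'm::ab_group_add \<Rightarrow> 'm) \<Rightarrow> ('m \<Rightarrow> 'b::ring_1 \<Rightarrow> 'm)
      \<Rightarrow> ('b \<Rightarrow> 'n::ab_group_add \<Rightarrow> 'n) \<Rightarrow> ('n \<Rightarrow> 'a \<Rightarrow> 'n)
      \<Rightarrow> ('m \<Rightarrow> 'n \<Rightarrow> 'a) \<Rightarrow> ('n \<Rightarrow> 'm \<Rightarrow> 'b)
      \<Rightarrow> ('a, 'm, 'n, 'b) gmat \<Rightarrow> ('a, 'm, 'n, 'b) gmat \<Rightarrow> ('a, 'm, 'n, 'b) gmat" where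
  "gmat_mult lactM ractM lactN ractN \<phi> \<psi> x y =
     GMat (entry11 x * entry11 y + \<phi> (entry12 x) (entry21 y))
          (lactM (entry11 x) (entry12 y) + ractM (entry12 x) (entry22 y))
          (ractN (entry21 x) (entry11 y) + lactN (entry22 x) (entry21 y))
          (\<psi> (entry21 x) (entry12 y) + entry22 x * entry22 y)"

text \<open>
  The classes \<open>ring_1\<close> and \<open>comm_ring_1\<close> exclude the zero ring. This is no restriction here: if the
  ground ring, \<open>A\<close> or \<open>B\<close> were zero, then \<open>M\<close> and \<open>N\<close> would both be zero, as the actions are unital.
\<close>

locale generalized_matrix_algebra =
  morita_context scaleA scaleB scaleM scaleN lactM ractM lactN ractN \<phi> \<psi>
  for scaleA :: "'r::comm_ring_1 \<Rightarrow> 'a::ring_1 \<Rightarrow> 'a"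
    and scaleB :: "'r \<Rightarrow> 'b::ring_1 \<Rightarrow> 'b"
    and scaleM :: "'r \<Rightarrow> 'm::ab_group_add \<Rightarrow> 'm"
    and scaleN :: "'r \<Rightarrow> 'n::ab_group_add \<Rightarrow> 'n"
    and lactM :: "'a \<Rightarrow> 'm \<Rightarrow> 'm"
    and ractM :: "'m \<Rightarrow> 'b \<Rightarrow> 'm"
    and lactN :: "'b \<Rightarrow> 'n \<Rightarrow> 'n"
    and ractN :: "'n \<Rightarrow> 'a \<Rightarrow> 'n"
    and \<phi> :: "'m \<Rightarrow> 'n \<Rightarrow> 'a"
    and \<psi> :: "'n \<Rightarrow> 'm \<Rightarrow> 'b" +
  assumes M_or_N_nonzero: "(\<exists>m::'m. m \<noteq> 0) \<or> (\<exists>n::'n. n \<noteq> 0)"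

definition left_faithful :: "('a::zero \<Rightarrow> 'm::zero \<Rightarrow> 'm) \<Rightarrow> bool" where
  "left_faithful lact \<longleftrightarrow> (\<forall>a. (\<forall>m. lact a m = 0) \<longrightarrow> a = 0)"

definition right_faithful :: "('m::zero \<Rightarrow> 'b::zero \<Rightarrow> 'm) \<Rightarrow> bool" where
  "right_faithful ract \<longleftrightarrow> (\<forall>b. (\<forall>m. ract m b = 0) \<longrightarrow> b = 0)"

definition strongly_faithful ::
    "('a::zero \<Rightarrow> 'm::zero \<Rightarrow> 'm) \<Rightarrow> ('m \<Rightarrow> 'b::zero \<Rightarrow> 'm) \<Rightarrow> bool" where
  "strongly_faithful lact ract \<longleftrightarrow>
     (right_faithful ract \<and> (\<forall>a m. lact a m = 0 \<longrightarrow> a = 0 \<or> m = 0)) \<or>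
     (left_faithful lact \<and> (\<forall>m b. ract m b = 0 \<longrightarrow> m = 0 \<or> b = 0))"

context morita_context
begin

abbreviation G_scale where "G_scale \<equiv> gmat_scale scaleA scaleB scaleM scaleN"
abbreviation G_mult where "G_mult \<equiv> gmat_mult lactM ractM lactN ractN \<phi> \<psi>"

lemmas add_rules =
  M.lact_linear_left[THEN module_hom.add] M.lact_linear_right[THEN module_hom.add]
  M.ract_linear_left[THEN module_hom.add] M.ract_linear_right[THEN module_hom.add]
  N.lact_linear_left[THEN module_hom.add] N.lact_linear_right[THEN module_hom.add]
  N.ract_linear_left[THEN module_hom.add] N.ract_linear_right[THEN module_hom.add]
  \<phi>_linear_left[THEN module_hom.add] \<phi>_linear_right[THEN module_hom.add]
  \<psi>_linear_left[THEN module_hom.add] \<psi>_linear_right[THEN module_hom.add]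

lemmas zero_rules =
  M.lact_linear_left[THEN module_hom.zero] M.lact_linear_right[THEN module_hom.zero]
  M.ract_linear_left[THEN module_hom.zero] M.ract_linear_right[THEN module_hom.zero]
  N.lact_linear_left[THEN module_hom.zero] N.lact_linear_right[THEN module_hom.zero]
  N.ract_linear_left[THEN module_hom.zero] N.ract_linear_right[THEN module_hom.zero]
  \<phi>_linear_left[THEN module_hom.zero] \<phi>_linear_right[THEN module_hom.zero]
  \<psi>_linear_left[THEN module_hom.zero] \<psi>_linear_right[THEN module_hom.zero]

lemmas scale_rules =
  M.A.mult_linear_left[THEN module_hom.scale] M.A.mult_linear_right[THEN module_hom.scale]
  M.B.mult_linear_left[THEN module_hom.scale] M.B.mult_linear_right[THEN module_hom.scale]
  M.lact_linear_left[THEN module_hom.scale] M.lact_linear_right[THEN module_hom.scale]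
  M.ract_linear_left[THEN module_hom.scale] M.ract_linear_right[THEN module_hom.scale]
  N.lact_linear_left[THEN module_hom.scale] N.lact_linear_right[THEN module_hom.scale]
  N.ract_linear_left[THEN module_hom.scale] N.ract_linear_right[THEN module_hom.scale]
  \<phi>_linear_left[THEN module_hom.scale] \<phi>_linear_right[THEN module_hom.scale]
  \<psi>_linear_left[THEN module_hom.scale] \<psi>_linear_right[THEN module_hom.scale]

lemmas module_rules =
  M.A.scale_right_distrib M.A.scale_left_distrib
  M.B.scale_right_distrib M.B.scale_left_distrib
  M.X.scale_right_distrib M.X.scale_left_distrib
  N.X.scale_right_distrib N.X.scale_left_distrib

lemma G_module: "module G_scale"
  by standard (simp_all add: gmat_scale_def plus_gmat_def module_rules)

lemma G_unital_algebra: "unital_algebra G_scale G_mult (GMat 1 0 0 1)"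
proof -
  interpret G: module G_scale by (rule G_module)
  show ?thesis
  proof
    fix x y z :: "('a, 'm, 'n, 'b) gmat"
    show "G_mult (G_mult x y) z = G_mult x (G_mult y z)"
      by (simp add: gmat_mult_def add_rules M.lact_mult M.ract_mult M.lact_ract
          N.lact_mult N.ract_mult N.lact_ract \<phi>_balanced \<phi>_lact \<phi>_ract
          \<psi>_balanced \<psi>_lact \<psi>_ract assoc_M assoc_N algebra_simps)
    show "G_mult (GMat 1 0 0 1) x = x" "G_mult x (GMat 1 0 0 1) = x"
      by (simp_all add: gmat_mult_def zero_rules M.lact_one M.ract_one N.lact_one N.ract_one)
  qed (simp_all add: gmat_mult_def gmat_scale_def plus_gmat_def add_rules scale_rules
      module_rules algebra_simps)
qed

lemma G_center:
  "alg_center G_mult =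
     {GMat a 0 0 b | a b. a \<in> alg_center (*) \<and> b \<in> alg_center (*) \<and>
        (\<forall>m. lactM a m = ractM m b) \<and> (\<forall>n. ractN n a = lactN b n)}"
proof (intro equalityI subsetI)
  fix z assume "z \<in> alg_center G_mult"
  then have c: "G_mult z x = G_mult x z" for x
    by (simp add: alg_center_def)
  obtain a m n b where z: "z = GMat a m n b" by (cases z)
  have "m = 0" "n = 0"
    using c[of "GMat 1 0 0 0"]
    by (simp_all add: z gmat_mult_def zero_rules M.lact_one N.ract_one)
  moreover have "a * a' = a' * a" for a'
    using c[of "GMat a' 0 0 0"] by (simp add: z gmat_mult_def zero_rules)
  moreover have "b * b' = b' * b" for b'
    using c[of "GMat 0 0 0 b'"] by (simp add: z gmat_mult_def zero_rules)
  moreover have "lactM a m' = ractM m' b" for m'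
    using c[of "GMat 0 m' 0 0"] by (simp add: z gmat_mult_def zero_rules)
  moreover have "ractN n' a = lactN b n'" for n'
    using c[of "GMat 0 0 n' 0"] by (simp add: z gmat_mult_def zero_rules)
  ultimately show "z \<in> {GMat a 0 0 b | a b. a \<in> alg_center (*) \<and> b \<in> alg_center (*) \<and>
        (\<forall>m. lactM a m = ractM m b) \<and> (\<forall>n. ractN n a = lactN b n)}"
    by (simp add: z alg_center_def)
qed (auto simp: alg_center_def gmat_mult_def zero_rules)

end

end

theory Submission
  imports Defs
begin

text \<open>
  The proof is by Peirce decomposition with respect to the idempotent \<open>e = 1 \<oplus> 0\<close>. Subtracting an
  inner derivation from the given Lie derivation \<open>L\<close>, one may assume that \<open>L e\<close> is diagonal. As
  bracketing with \<open>e\<close> is \<open>0\<close> on diagonal matrices, \<open>1\<close> on \<open>M\<close> and \<open>- 1\<close> on \<open>N\<close>, and \<open>N\<close> and \<open>M\<close>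
  are \<open>2\<close>-torsion free, \<open>L\<close> then preserves the diagonal, \<open>M\<close> and \<open>N\<close>
  (\<open>lie_derivation_diagonal_form\<close>), say
    \<open>L (a, m, n, b) = (P a + Q b, T m, S n, R a + U b)\<close>,
  and \<open>R\<close> and \<open>Q\<close> take values in the centers of \<open>B\<close> and \<open>A\<close>, because \<open>A\<close> and \<open>B\<close> commute.

  By the hypothesis on the projections of the center there are central matrices \<open>\<rho> a \<oplus> R a\<close> and
  \<open>Q b \<oplus> \<sigma> b\<close>. Their sum is the central part \<open>\<tau>\<close>; it is linear since \<open>M\<close> is faithful on both sides,
  so that either diagonal entry of a central matrix determines the other. Put
  \<open>P' = P - \<rho>\<close> and \<open>U' = U - \<sigma>\<close>. The remainder \<open>L - \<tau> = (P', T, S, U')\<close> respects the products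
  \<open>a m\<close>, \<open>m b\<close>, \<open>n a\<close>, \<open>b n\<close>, and hence, by faithfulness, also the products of \<open>A\<close> and of \<open>B\<close>.

  What remains are the products \<open>m n\<close> and \<open>n m\<close>. With \<open>z(m,n) = Q (n m) - \<rho> (m n)\<close> and
  \<open>w(m,n) = \<sigma> (n m) - R (m n)\<close> one has
    \<open>P' (m n) = T m n + m S n + z(m,n)\<close> and \<open>U' (n m) = S n m + n T m - w(m,n)\<close>,
  where \<open>z(m,n) \<oplus> w(m,n)\<close> is central. Evaluating \<open>T\<close> on both sides of \<open>(m n) m' = m (n m')\<close> gives
  \<open>z(m,n) m' + z(m',n) m = 0\<close>. For \<open>m' = m\<close> this reads \<open>2 z(m,n) m = 0\<close>, so
  \<open>z(m,n) m = 0 = m w(m,n)\<close>, and strong faithfulness forces \<open>z = 0\<close> and \<open>w = 0\<close>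
  (\<open>defect_vanishes\<close>).
\<close>

section \<open>Inner derivations and proper Lie derivations\<close>

context unital_algebra
begin

lemmas mult_add = mult_linear_left[THEN module_hom.add] mult_linear_right[THEN module_hom.add]

lemmas mult_diff = mult_linear_left[THEN module_hom.diff] mult_linear_right[THEN module_hom.diff]

lemma module_pair_self: "module_pair scale scale"
  by (simp add: module_axioms module_pair_def)

lemma inner_derivation: "derivation scale mult (\<lambda>y. lie_bracket mult y x)"
proof -
  have "module_hom scale scale (\<lambda>y. lie_bracket mult y x)"
    using mult_linear_left[of x] mult_linear_right[of x]
    unfolding lie_bracket_def by (rule module_pair.module_hom_sub[OF module_pair_self])
  then show ?thesis
    by (simp add: derivation_def lie_bracket_def mult_diff mult_assoc algebra_simps)
qed

lemma derivation_imp_lie_derivation: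
  assumes "derivation scale mult D"
  shows "lie_derivation scale mult D"
proof -
  have hom: "module_hom scale scale D" and D: "D (mult x y) = mult (D x) y + mult x (D y)" for x y
    using assms by (simp_all add: derivation_def)
  show ?thesis
    by (simp add: lie_derivation_def lie_bracket_def hom module_hom.diff[OF hom] D)
qed

lemma derivation_add:
  assumes "derivation scale mult D" "derivation scale mult E"
  shows "derivation scale mult (\<lambda>x. D x + E x)"
proof -
  have "module_hom scale scale (\<lambda>x. D x + E x)"
    using assms by (intro module_pair.module_hom_add[OF module_pair_self]) (simp_all add: derivation_def)
  with assms show ?thesis
    by (simp add: derivation_def mult_add algebra_simps)
qed

lemma lie_derivation_diff:
  assumes "lie_derivation scale mult L" "lie_derivation scale mult K"
  shows "lie_derivation scale mult (\<lambda>x. L x - K x)"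
proof -
  have "module_hom scale scale (\<lambda>x. L x - K x)"
    using assms
    by (intro module_pair.module_hom_sub[OF module_pair_self]) (simp_all add: lie_derivation_def)
  with assms show ?thesis
    by (auto simp: lie_derivation_def lie_bracket_def mult_diff)
qed

lemma proper_if_diff_derivation_proper:
  assumes L: "lie_derivation scale mult L"
    and D: "derivation scale mult D"
    and proper: "proper_lie_derivation scale mult (\<lambda>x. L x - D x)"
  shows "proper_lie_derivation scale mult L"
proof -
  obtain E \<tau> where E: "derivation scale mult E" and \<tau>: "module_hom scale scale \<tau>"
      "range \<tau> \<subseteq> alg_center mult" and eq: "\<And>x. L x - D x = E x + \<tau> x"
    using proper unfolding proper_lie_derivation_def by blast
  have "L x = (E x + D x) + \<tau> x" for x
    using eq[of x] by (simp add: algebra_simps)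
  with L \<tau> derivation_add[OF E D] show ?thesis
    unfolding proper_lie_derivation_def by blast
qed

lemma alg_center_add:
  assumes "x \<in> alg_center mult" "y \<in> alg_center mult"
  shows "x + y \<in> alg_center mult"
  using assms by (simp add: alg_center_def mult_add)

end

section \<open>Lie derivations of diagonal form\<close>

context morita_context
begin

lemmas diff_rules =
  M.lact_linear_left[THEN module_hom.diff] M.lact_linear_right[THEN module_hom.diff]
  M.ract_linear_left[THEN module_hom.diff] M.ract_linear_right[THEN module_hom.diff]
  N.lact_linear_left[THEN module_hom.diff] N.lact_linear_right[THEN module_hom.diff]
  N.ract_linear_left[THEN module_hom.diff] N.ract_linear_right[THEN module_hom.diff]
  \<phi>_linear_left[THEN module_hom.diff] \<phi>_linear_right[THEN module_hom.diff]
  \<psi>_linear_left[THEN module_hom.diff] \<psi>_linear_right[THEN module_hom.diff]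

lemmas gmat_simps =
  gmat_mult_def gmat_scale_def plus_gmat_def minus_gmat_def zero_gmat_def zero_rules
  M.lact_one M.ract_one N.lact_one N.ract_one

text \<open>
  The matrix \<open>x\<close> is chosen such that \<open>[e, x]\<close> is the off-diagonal part of \<open>y\<close>; this is applied
  with \<open>y = L e\<close>.
\<close>

lemma inner_derivation_diagonalizes:
  assumes "x = GMat 0 (entry12 y) (- entry21 y) 0"
  shows "entry12 (y - lie_bracket G_mult (GMat 1 0 0 0) x) = 0"
    and "entry21 (y - lie_bracket G_mult (GMat 1 0 0 0) x) = 0"
  by (simp_all add: assms lie_bracket_def gmat_simps)

lemma lie_derivation_diagonal_form:
  assumes L: "lie_derivation G_scale G_mult L"
    and e: "entry12 (L (GMat 1 0 0 0)) = 0" "entry21 (L (GMat 1 0 0 0)) = 0"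
    and tfM: "\<forall>m::'m. m + m = 0 \<longrightarrow> m = 0"
    and tfN: "\<forall>n::'n. n + n = 0 \<longrightarrow> n = 0"
  obtains P Q R U T S where
    "\<And>a m n b. L (GMat a m n b) = GMat (P a + Q b) (T m) (S n) (R a + U b)"
    "P 0 = 0" "Q 0 = 0" "R 0 = 0" "U 0 = 0" "T 0 = 0" "S 0 = 0"
proof -
  have hom: "module_hom G_scale G_scale L"
    and br: "L (lie_bracket G_mult x y) = lie_bracket G_mult (L x) y + lie_bracket G_mult x (L y)" for x y
    using L by (simp_all add: lie_derivation_def)
  note add = module_hom.add[OF hom] and zero = module_hom.zero[OF hom]
  obtain \<alpha> \<beta> where Le: "L (GMat 1 0 0 0) = GMat \<alpha> 0 0 \<beta>"
    using e by (cases "L (GMat 1 0 0 0)") simp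
  have dA: "entry12 (L (GMat a 0 0 0)) = 0" "entry21 (L (GMat a 0 0 0)) = 0" for a
    using br[of "GMat 1 0 0 0" "GMat a 0 0 0"] zero
    by (cases "L (GMat a 0 0 0)"; simp add: lie_bracket_def gmat_simps Le)+
  have dB: "entry12 (L (GMat 0 0 0 b)) = 0" "entry21 (L (GMat 0 0 0 b)) = 0" for b
    using br[of "GMat 1 0 0 0" "GMat 0 0 0 b"] zero
    by (cases "L (GMat 0 0 0 b)"; simp add: lie_bracket_def gmat_simps Le)+
  have dM: "entry11 (L (GMat 0 m 0 0)) = 0" "entry22 (L (GMat 0 m 0 0)) = 0"
    "entry21 (L (GMat 0 m 0 0)) = 0" for m
  proof -
    obtain a' m' n' b' where Lm: "L (GMat 0 m 0 0) = GMat a' m' n' b'" by (cases "L (GMat 0 m 0 0)")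
    have "a' = 0" "b' = 0" "n' = - n'"
      using br[of "GMat 1 0 0 0" "GMat 0 m 0 0"] by (simp_all add: lie_bracket_def gmat_simps Le Lm)
    moreover have "n' = 0" using tfN \<open>n' = - n'\<close> by (metis add.right_inverse)
    ultimately show "entry11 (L (GMat 0 m 0 0)) = 0" "entry22 (L (GMat 0 m 0 0)) = 0"
      "entry21 (L (GMat 0 m 0 0)) = 0" by (simp_all add: Lm)
  qed
  have dN: "entry11 (L (GMat 0 0 n 0)) = 0" "entry22 (L (GMat 0 0 n 0)) = 0"
    "entry12 (L (GMat 0 0 n 0)) = 0" for n
  proof -
    obtain a' m' n' b' where Ln: "L (GMat 0 0 n 0) = GMat a' m' n' b'" by (cases "L (GMat 0 0 n 0)")
    have "a' = 0" "b' = 0" "m' = - m'"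
      using br[of "GMat 0 0 n 0" "GMat 1 0 0 0"] by (simp_all add: lie_bracket_def gmat_simps Le Ln)
    moreover have "m' = 0" using tfM \<open>m' = - m'\<close> by (metis add.right_inverse)
    ultimately show "entry11 (L (GMat 0 0 n 0)) = 0" "entry22 (L (GMat 0 0 n 0)) = 0"
      "entry12 (L (GMat 0 0 n 0)) = 0" by (simp_all add: Ln)
  qed
  have split: "GMat a m n b = GMat a 0 0 0 + GMat 0 m 0 0 + GMat 0 0 n 0 + GMat 0 0 0 b" for a m n b
    by (simp add: plus_gmat_def)
  show thesis
  proof (rule that)
    show "L (GMat a m n b) = GMat (entry11 (L (GMat a 0 0 0)) + entry11 (L (GMat 0 0 0 b)))
        (entry12 (L (GMat 0 m 0 0))) (entry21 (L (GMat 0 0 n 0)))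
        (entry22 (L (GMat a 0 0 0)) + entry22 (L (GMat 0 0 0 b)))" for a m n b
      by (subst split) (simp only: add, simp add: plus_gmat_def dA dB dM dN)
  qed (use zero in \<open>simp_all add: zero_gmat_def\<close>)
qed

end

section \<open>Splitting off the central part\<close>

text \<open>
  A Lie derivation of diagonal form, with the assumptions on \<open>M\<close> under which it is proper.
  Faithfulness on both sides follows from strong faithfulness
  (\<open>strongly_faithful_imp_faithful\<close>) and is listed for convenience. The functions \<open>\<rho>\<close> and \<open>\<sigma>\<close>
  select central matrices \<open>\<rho> a \<oplus> R a\<close> and \<open>Q b \<oplus> \<sigma> b\<close>; they are arbitrary functions here, and
  their linearity (\<open>lift_linear\<close>) is a consequence of faithfulness.
\<close>

locale diagonal_lie_derivation =
  morita_context scaleA scaleB scaleM scaleN lactM ractM lactN ractN \<phi> \<psi>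
  for scaleA :: "'r::comm_ring_1 \<Rightarrow> 'a::ring_1 \<Rightarrow> 'a"
    and scaleB :: "'r \<Rightarrow> 'b::ring_1 \<Rightarrow> 'b"
    and scaleM :: "'r \<Rightarrow> 'm::ab_group_add \<Rightarrow> 'm"
    and scaleN :: "'r \<Rightarrow> 'n::ab_group_add \<Rightarrow> 'n"
    and lactM :: "'a \<Rightarrow> 'm \<Rightarrow> 'm"
    and ractM :: "'m \<Rightarrow> 'b \<Rightarrow> 'm"
    and lactN :: "'b \<Rightarrow> 'n \<Rightarrow> 'n"
    and ractN :: "'n \<Rightarrow> 'a \<Rightarrow> 'n"
    and \<phi> :: "'m \<Rightarrow> 'n \<Rightarrow> 'a"
    and \<psi> :: "'n \<Rightarrow> 'm \<Rightarrow> 'b" +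
  fixes L :: "('a, 'm, 'n, 'b) gmat \<Rightarrow> ('a, 'm, 'n, 'b) gmat"
    and P :: "'a \<Rightarrow> 'a" and Q :: "'b \<Rightarrow> 'a" and R :: "'a \<Rightarrow> 'b" and U :: "'b \<Rightarrow> 'b"
    and T :: "'m \<Rightarrow> 'm" and S :: "'n \<Rightarrow> 'n"
    and \<rho> :: "'a \<Rightarrow> 'a" and \<sigma> :: "'b \<Rightarrow> 'b"
  assumes lie: "lie_derivation G_scale G_mult L"
    and form: "L (GMat a m n b) = GMat (P a + Q b) (T m) (S n) (R a + U b)"
    and zero_values: "P 0 = 0" "Q 0 = 0" "R 0 = 0" "U 0 = 0" "T 0 = 0" "S 0 = 0"
    and center_\<rho>: "GMat (\<rho> a) 0 0 (R a) \<in> alg_center G_mult"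
    and center_\<sigma>: "GMat (Q b) 0 0 (\<sigma> b) \<in> alg_center G_mult"
    and torsion_free: "m + m = 0 \<Longrightarrow> m = (0::'m)"
    and left_faithful: "left_faithful lactM"
    and right_faithful: "right_faithful ractM"
    and strongly_faithful: "strongly_faithful lactM ractM"
begin

sublocale G: unital_algebra G_scale G_mult "GMat 1 0 0 1"
  by (rule G_unital_algebra)

lemma L_hom: "module_hom G_scale G_scale L"
  using lie by (simp add: lie_derivation_def)

lemma L_bracket:
  "L (lie_bracket G_mult x y) = lie_bracket G_mult (L x) y + lie_bracket G_mult x (L y)"
  using lie by (simp add: lie_derivation_def)

lemma component_add:
  "P (a + a') = P a + P a'" "Q (b + b') = Q b + Q b'" "R (a + a') = R a + R a'"
  "U (b + b') = U b + U b'" "T (m + m') = T m + T m'" "S (n + n') = S n + S n'"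
  using module_hom.add[OF L_hom, of "GMat a m n 0" "GMat a' m' n' 0"]
    module_hom.add[OF L_hom, of "GMat 0 0 0 b" "GMat 0 0 0 b'"]
  by (simp_all add: form gmat_simps zero_values)

lemma component_scale: "Q (scaleB r b) = scaleA r (Q b)" "R (scaleA r a) = scaleB r (R a)"
  using module_hom.scale[OF L_hom, of r "GMat a 0 0 0"] module_hom.scale[OF L_hom, of r "GMat 0 0 0 b"]
  by (simp_all add: form gmat_simps zero_values)

lemma component_neg: "Q (- b) = - Q b" "U (- b) = - U b"
  using component_add(2)[of b "- b"] component_add(4)[of b "- b"]
  by (simp_all add: zero_values eq_neg_iff_add_eq_0 add.commute)

lemma central_\<rho>:
  "\<rho> a * a' = a' * \<rho> a" "b * R a = R a * b"
  "lactM (\<rho> a) m = ractM m (R a)" "ractN n (\<rho> a) = lactN (R a) n"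
  using center_\<rho>[of a] unfolding G_center by (auto simp: alg_center_def)

lemma central_\<sigma>:
  "Q b * a = a * Q b" "b' * \<sigma> b = \<sigma> b * b'"
  "lactM (Q b) m = ractM m (\<sigma> b)" "ractN n (Q b) = lactN (\<sigma> b) n"
  using center_\<sigma>[of b] unfolding G_center by (auto simp: alg_center_def)

lemma eq_if_lactM_eq: "a = a'" if "\<And>m. lactM a m = lactM a' m"
proof -
  have "lactM (a - a') m = 0" for m by (simp add: diff_rules that)
  then show ?thesis using left_faithful unfolding left_faithful_def by fastforce
qed

lemma eq_if_ractM_eq: "b = b'" if "\<And>m. ractM m b = ractM m b'"
proof -
  have "ractM m (b - b') = 0" for m by (simp add: diff_rules that)
  then show ?thesis using right_faithful unfolding right_faithful_def by fastforce
qed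

lemma lift_linear:
  "\<rho> (a + a') = \<rho> a + \<rho> a'" "\<rho> (scaleA r a) = scaleA r (\<rho> a)"
  "\<sigma> (b + b') = \<sigma> b + \<sigma> b'" "\<sigma> (scaleB r b) = scaleB r (\<sigma> b)"
proof -
  show "\<rho> (a + a') = \<rho> a + \<rho> a'" "\<rho> (scaleA r a) = scaleA r (\<rho> a)"
    by (rule eq_if_lactM_eq, simp add: central_\<rho> add_rules scale_rules component_add component_scale)+
  show "\<sigma> (b + b') = \<sigma> b + \<sigma> b'" "\<sigma> (scaleB r b) = scaleB r (\<sigma> b)"
    by (rule eq_if_ractM_eq,
        simp add: central_\<sigma>[symmetric] add_rules scale_rules component_add component_scale)+
qed

text \<open>
  The central part of \<open>L\<close>, and the two diagonal components \<open>P'\<close> and \<open>U'\<close> of the remainder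
  \<open>L - \<tau>\<close>.
\<close>

definition \<tau> :: "('a, 'm, 'n, 'b) gmat \<Rightarrow> ('a, 'm, 'n, 'b) gmat" where
  "\<tau> x = GMat (\<rho> (entry11 x)) 0 0 (R (entry11 x)) + GMat (Q (entry22 x)) 0 0 (\<sigma> (entry22 x))"

definition P' :: "'a \<Rightarrow> 'a" where "P' a = P a - \<rho> a"
definition U' :: "'b \<Rightarrow> 'b" where "U' b = U b - \<sigma> b"

lemma \<tau>_central: "\<tau> x \<in> alg_center G_mult"
  unfolding \<tau>_def by (intro G.alg_center_add center_\<rho> center_\<sigma>)

lemma \<tau>_hom: "module_hom G_scale G_scale \<tau>"
  by unfold_locales
    (simp_all add: \<tau>_def gmat_simps component_add component_scale lift_linear module_rules algebra_simps)

lemma L_minus_\<tau>: "L x - \<tau> x = GMat (P' (entry11 x)) (T (entry12 x)) (S (entry21 x)) (U' (entry22 x))"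
  by (cases x) (simp add: form \<tau>_def P'_def U'_def gmat_simps)

lemma corner_add: "P' (a + a') = P' a + P' a'" "U' (b + b') = U' b + U' b'"
  by (simp_all add: P'_def U'_def component_add lift_linear)

lemma T_actions: "T (lactM a m) = lactM (P' a) m + lactM a (T m)"
  "T (ractM m b) = ractM (T m) b + ractM m (U' b)"
  using L_bracket[of "GMat a 0 0 0" "GMat 0 m 0 0"] L_bracket[of "GMat 0 m 0 0" "GMat 0 0 0 b"]
  by (simp_all add: lie_bracket_def gmat_simps form zero_values P'_def U'_def diff_rules
     central_\<rho> central_\<sigma>)

lemma S_actions: "S (ractN n a) = ractN (S n) a + ractN n (P' a)"
  "S (lactN b n) = lactN (U' b) n + lactN b (S n)"
  using L_bracket[of "GMat 0 0 n 0" "GMat a 0 0 0"] L_bracket[of "GMat 0 0 0 b" "GMat 0 0 n 0"]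
  by (simp_all add: lie_bracket_def gmat_simps form zero_values P'_def U'_def diff_rules
     central_\<rho> central_\<sigma>)

text \<open>Compare the two expressions for \<open>T ((a a') m) = T (a (a' m))\<close> and cancel \<open>M\<close>.\<close>

lemma P'_mult: "P' (a * a') = P' a * a' + a * P' a'"
proof (rule eq_if_lactM_eq)
  fix m
  have "lactM (P' (a * a')) m + lactM a (lactM a' (T m)) = T (lactM a (lactM a' m))"
    using T_actions(1)[of "a * a'" m] by (simp add: M.lact_mult)
  also have "\<dots> = lactM (P' a * a' + a * P' a') m + lactM a (lactM a' (T m))"
    by (simp add: T_actions add_rules M.lact_mult algebra_simps)
  finally show "lactM (P' (a * a')) m = lactM (P' a * a' + a * P' a') m" by simp
qed

lemma U'_mult: "U' (b * b') = U' b * b' + b * U' b'"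
proof (rule eq_if_ractM_eq)
  fix m
  have "ractM m (U' (b * b')) + ractM (ractM (T m) b) b' = T (ractM (ractM m b) b')"
    using T_actions(2)[of m "b * b'"] by (simp add: M.ract_mult)
  also have "\<dots> = ractM m (U' b * b' + b * U' b') + ractM (ractM (T m) b) b'"
    by (simp add: T_actions add_rules M.ract_mult algebra_simps)
  finally show "ractM m (U' (b * b')) = ractM m (U' b * b' + b * U' b')" by simp
qed

section \<open>The products between \<open>M\<close> and \<open>N\<close>\<close>

text \<open>
  The two diagonal entries of the central matrix measuring how far \<open>L - \<tau>\<close> is from respecting
  the products \<open>m n\<close> and \<open>n m\<close>.
\<close>

definition z :: "'m \<Rightarrow> 'n \<Rightarrow> 'a" where "z m n = Q (\<psi> n m) - \<rho> (\<phi> m n)"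
definition w :: "'m \<Rightarrow> 'n \<Rightarrow> 'b" where "w m n = \<sigma> (\<psi> n m) - R (\<phi> m n)"

lemma lactM_z: "lactM (z m n) m' = ractM m' (w m n)"
  by (simp add: z_def w_def diff_rules central_\<rho> central_\<sigma>)

lemma P'_\<phi>: "P' (\<phi> m n) = \<phi> (T m) n + \<phi> m (S n) + z m n"
  and U'_\<psi>: "U' (\<psi> n m) = \<psi> (S n) m + \<psi> n (T m) - w m n"
  using L_bracket[of "GMat 0 m 0 0" "GMat 0 0 n 0"]
  by (simp_all add: lie_bracket_def gmat_simps form zero_values P'_def U'_def z_def w_def
      component_neg algebra_simps)

text \<open>Two ways of evaluating \<open>T\<close> at \<open>(m n) m' = m (n m')\<close>.\<close>

lemma defect_identity: "lactM (z m n) m' + lactM (z m' n) m = 0"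
proof -
  have "lactM (P' (\<phi> m n)) m' + lactM (\<phi> m n) (T m') =
      ractM (T m) (\<psi> n m') + ractM m (U' (\<psi> n m'))"
    using arg_cong[OF assoc_M[of m n m'], of T] by (simp only: T_actions)
  then show ?thesis
    by (simp add: P'_\<phi> U'_\<psi> add_rules diff_rules assoc_M lactM_z algebra_simps)
qed

lemma defect_vanishes: "z m n = 0" "w m n = 0"
proof -
  \<comment> \<open>The identity at \<open>m' = m\<close> is \<open>2 z(m,n) m = 0\<close>.\<close>
  have zm: "lactM (z m n) m = 0"
    using torsion_free defect_identity by blast
  have mw: "ractM m (w m n) = 0"
    using zm by (simp add: lactM_z)
  have z_iff_w: "z m n = 0 \<longleftrightarrow> w m n = 0"
    using eq_if_lactM_eq[of "z m n" 0] eq_if_ractM_eq[of "w m n" 0]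
    by (auto simp: zero_rules lactM_z) (metis lactM_z zero_rules)
  have "z m n = 0" if "m = 0"
    using lift_linear(1)[of 0 0] by (simp add: that z_def zero_rules zero_values)
  then show "z m n = 0"
    using strongly_faithful zm mw z_iff_w unfolding strongly_faithful_def by blast
  with z_iff_w show "w m n = 0" by simp
qed

lemma derivation_L_minus_\<tau>: "derivation G_scale G_mult (\<lambda>x. L x - \<tau> x)"
proof -
  have "module_hom G_scale G_scale (\<lambda>x. L x - \<tau> x)"
    using L_hom \<tau>_hom by (rule module_pair.module_hom_sub[OF G.module_pair_self])
  moreover have "L (G_mult x y) - \<tau> (G_mult x y) =
      G_mult (L x - \<tau> x) y + G_mult x (L y - \<tau> y)" for x y
    unfolding L_minus_\<tau>
    by (simp add: gmat_mult_def plus_gmat_def corner_add component_add T_actions S_actions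
        P'_mult U'_mult P'_\<phi> U'_\<psi> defect_vanishes algebra_simps)
  ultimately show ?thesis
    by (simp add: derivation_def)
qed

lemma proper: "proper_lie_derivation G_scale G_mult L"
proof -
  have "L x = (L x - \<tau> x) + \<tau> x" for x by simp
  then show ?thesis
    using lie derivation_L_minus_\<tau> \<tau>_hom \<tau>_central unfolding proper_lie_derivation_def by blast
qed

end

section \<open>The Lie derivation property\<close>

lemma (in morita_context) central_lift_exists:
  "a \<in> entry11 ` alg_center G_mult \<Longrightarrow> \<exists>d. GMat a 0 0 d \<in> alg_center G_mult"
  "b \<in> entry22 ` alg_center G_mult \<Longrightarrow> \<exists>c. GMat c 0 0 b \<in> alg_center G_mult"
  unfolding G_center by auto

lemma (in morita_context) strongly_faithful_imp_faithful:
  assumes "strongly_faithful lactM ractM"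
  shows "left_faithful lactM" "right_faithful ractM"
proof -
  \<comment> \<open>Faithfulness over a nonzero ring provides a nonzero element of \<open>M\<close>.\<close>
  have "\<exists>m::'m. m \<noteq> 0"
  proof (rule ccontr)
    assume "\<nexists>m::'m. m \<noteq> 0"
    then have "(1::'a) = 0 \<or> (1::'b) = 0"
      using assms unfolding strongly_faithful_def left_faithful_def right_faithful_def by blast
    then show False by simp
  qed
  then show "left_faithful lactM" "right_faithful ractM"
    using assms unfolding strongly_faithful_def left_faithful_def right_faithful_def by blast+
qed

theorem theorem3p3:
  fixes scaleA :: "'r::comm_ring_1 \<Rightarrow> 'a::ring_1 \<Rightarrow> 'a"
    and scaleB :: "'r \<Rightarrow> 'b::ring_1 \<Rightarrow> 'b"
    and scaleM :: "'r \<Rightarrow> 'm::ab_group_add \<Rightarrow> 'm"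
    and scaleN :: "'r \<Rightarrow> 'n::ab_group_add \<Rightarrow> 'n"
    and lactM :: "'a \<Rightarrow> 'm \<Rightarrow> 'm"
    and ractM :: "'m \<Rightarrow> 'b \<Rightarrow> 'm"
    and lactN :: "'b \<Rightarrow> 'n \<Rightarrow> 'n"
    and ractN :: "'n \<Rightarrow> 'a \<Rightarrow> 'n"
    and \<phi> :: "'m \<Rightarrow> 'n \<Rightarrow> 'a"
    and \<psi> :: "'n \<Rightarrow> 'm \<Rightarrow> 'b"
  assumes "generalized_matrix_algebra scaleA scaleB scaleM scaleN lactM ractM lactN ractN \<phi> \<psi>"
    and "\<forall>m::'m. m + m = 0 \<longrightarrow> m = 0"
    and "\<forall>n::'n. n + n = 0 \<longrightarrow> n = 0"
    and "entry11 ` alg_center (gmat_mult lactM ractM lactN ractN \<phi> \<psi>)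
           = alg_center ((*) :: 'a \<Rightarrow> 'a \<Rightarrow> 'a)"
    and "entry22 ` alg_center (gmat_mult lactM ractM lactN ractN \<phi> \<psi>)
           = alg_center ((*) :: 'b \<Rightarrow> 'b \<Rightarrow> 'b)"
    and "strongly_faithful lactM ractM"
  shows "lie_derivation_property (gmat_scale scaleA scaleB scaleM scaleN)
           (gmat_mult lactM ractM lactN ractN \<phi> \<psi>)"
proof -
  interpret generalized_matrix_algebra scaleA scaleB scaleM scaleN lactM ractM lactN ractN \<phi> \<psi>
    by (fact assms(1))
  interpret G: unital_algebra G_scale G_mult "GMat 1 0 0 1"
    by (rule G_unital_algebra)
  have proper: "proper_lie_derivation G_scale G_mult L"
    if L: "lie_derivation G_scale G_mult L" for L
  proof -
    let ?e = "GMat 1 0 0 0"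
    define x :: "('a, 'm, 'n, 'b) gmat" where "x = GMat 0 (entry12 (L ?e)) (- entry21 (L ?e)) 0"
    define D where "D y = lie_bracket G_mult y x" for y
    define K where "K y = L y - D y" for y
    \<comment> \<open>Replacing \<open>L\<close> by \<open>K\<close> achieves that the image of \<open>e\<close> is diagonal.\<close>
    have D: "derivation G_scale G_mult D"
      unfolding D_def by (rule G.inner_derivation)
    have K: "lie_derivation G_scale G_mult K"
      unfolding K_def using L G.derivation_imp_lie_derivation[OF D] by (rule G.lie_derivation_diff)
    have "entry12 (K ?e) = 0" "entry21 (K ?e) = 0"
      unfolding K_def D_def by (rule inner_derivation_diagonalizes[OF x_def])+
    from lie_derivation_diagonal_form[OF K this assms(2,3)]
    obtain P Q R U T S where
      form: "\<And>a m n b. K (GMat a m n b) = GMat (P a + Q b) (T m) (S n) (R a + U b)"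
      and zeros: "P 0 = 0" "Q 0 = 0" "R 0 = 0" "U 0 = 0" "T 0 = 0" "S 0 = 0"
      by metis
    \<comment> \<open>The diagonal copies of \<open>A\<close> and \<open>B\<close> commute.\<close>
    have "R a * b = b * R a" "Q b * a = a * Q b" for a b
    proof -
      have "K (lie_bracket G_mult (GMat a 0 0 0) (GMat 0 0 0 b)) =
          lie_bracket G_mult (K (GMat a 0 0 0)) (GMat 0 0 0 b) +
          lie_bracket G_mult (GMat a 0 0 0) (K (GMat 0 0 0 b))"
        using K by (simp add: lie_derivation_def)
      then show "R a * b = b * R a" "Q b * a = a * Q b"
        by (simp_all add: lie_bracket_def gmat_simps form zeros)
    qed
    then have "R a \<in> alg_center (*)" "Q b \<in> alg_center (*)" for a b
      by (simp_all add: alg_center_def)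
    then have "\<exists>c. GMat c 0 0 (R a) \<in> alg_center G_mult" "\<exists>d. GMat (Q b) 0 0 d \<in> alg_center G_mult"
      for a b
      by (simp_all add: central_lift_exists assms(4,5))
    then obtain \<rho> \<sigma> where
      lifts: "\<And>a. GMat (\<rho> a) 0 0 (R a) \<in> alg_center G_mult"
        "\<And>b. GMat (Q b) 0 0 (\<sigma> b) \<in> alg_center G_mult"
      by metis
    interpret diagonal_lie_derivation scaleA scaleB scaleM scaleN lactM ractM lactN ractN \<phi> \<psi>
        K P Q R U T S \<rho> \<sigma>
      by unfold_locales
        (fact K form zeros lifts assms(2)[rule_format] assms(6)
          strongly_faithful_imp_faithful[OF assms(6)])+
    show ?thesis
      using L D proper[unfolded K_def] by (rule G.proper_if_diff_derivation_proper)
  qed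
  then show ?thesis
    by (simp add: lie_derivation_property_def)
qed

end
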